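(* Let $d\ge 0$, $n\ge 2$ and $0\le k\le d$ be integers, let $p\in[0,1]$ and $q=1-p$, and let $C$ be the random cubical complex of the $d$-dimensional voxel model with parameters $n$ and $p$. The expected value of $\mu_k(C)$, normalized by volume, is a polynomial in $q$ of degree $2^{d-k}$, given by $$E_{d,k}(q)=\frac{1}{n^d}\,\mathbb{E}(\mu_k(C))=\begin{cases}\displaystyle\sum_{i=k}^{d}(-1)^{i-k+1}\binom{d}{i}\binom{i}{k}q^{2^{d-i}} & \text{if } k<d,\\[2mm] 1-q=p & \text{if } k=d.\end{cases}$$
   Context: The lattice $\mathcal{L}$ is the $d$-dimensional torus $(\mathbb{R}/n\mathbb{Z})^d$ subdivided into $n^d$ unit $d$-cubes. An open $i$-cube of $\mathcal{L}$ ($0\le i\le d$) is a product of $d$ factors, each of which is either a point $\{a\}$ or an open unit interval $(a,a+1)$ with $a\in\mathbb{Z}/n\mathbb{Z}$, with exactly $i$ factors being intervals; $\mathcal{L}$ is the disjoint union of its open cubes. An open cube $X$ is a face of a cube $Y$ if $X$ is contained in the closure of $Y$ (each cube is a face of itself). Intrinsic volumes: an open $i$-cube has $k$-th intrinsic volume $(-1)^{i-k}\binom{i}{k}$ (which is $0$ if $k>i$), and if $C$ is a union of open cubes of $\mathcal{L}$ then $\mu_k(C)$ is the sum of the $k$-th intrinsic volumes of the open cubes contained in $C$. Voxel model: the $d$-cubes of $\mathcal{L}$ are selected independently, each with probability $p$; $C$ is the union of the closures of the selected $d$-cubes. Equivalently, an open $i$-cube with $i<d$ belongs to $C$ exactly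 when it is a face of a selected $d$-cube. *)

theory Defs
  imports "HOL-Probability.Probability"
begin

definition circle_rel :: "nat \<Rightarrow> (real \<times> real) set" where
  "circle_rel n = {(x, y). \<exists>m::int. y - x = of_int m * real n}"

definition circle_proj :: "nat \<Rightarrow> real \<Rightarrow> real set" where
  "circle_proj n x = circle_rel n `` {x}"

(* A point of R/nZ is a coset of nZ in the reals; the topology is the quotient topology. *)
definition circle :: "nat \<Rightarrow> real set topology" where
  "circle n = topology (\<lambda>U. U \<subseteq> UNIV // circle_rel n \<and> open (circle_proj n -` U))"

definition torus :: "nat \<Rightarrow> nat \<Rightarrow> (nat \<Rightarrow> real set) topology" where
  "torus d n = product_topology (\<lambda>_. circle n) {..<d}"

lemma circle_proj_in_quotient: "circle_proj n x \<in> UNIV // circle_rel n"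
  by (simp add: circle_proj_def quotientI)

lemma openin_circle:
  "openin (circle n) U \<longleftrightarrow> U \<subseteq> UNIV // circle_rel n \<and> open (circle_proj n -` U)"
proof -
  have "istopology (\<lambda>U. U \<subseteq> UNIV // circle_rel n \<and> open (circle_proj n -` U))"
    unfolding istopology_def by (auto simp: vimage_Union)
  then show ?thesis
    by (simp add: circle_def topology_inverse')
qed

lemma topspace_circle: "topspace (circle n) = UNIV // circle_rel n"
proof -
  have "circle_proj n -` (UNIV // circle_rel n) = UNIV"
    by (auto simp: circle_proj_in_quotient)
  then have "openin (circle n) (UNIV // circle_rel n)"
    by (simp add: openin_circle)
  then show ?thesis
    by (metis openin_circle openin_subset openin_topspace subset_antisym)
qed

definition vertex :: "nat \<Rightarrow> nat \<Rightarrow> real set set" where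
  "vertex n a = {circle_proj n (real a)}"

definition edge :: "nat \<Rightarrow> nat \<Rightarrow> real set set" where
  "edge n a = circle_proj n ` {real a <..< real a + 1}"

(* The open i-cubes, as subsets of the torus: J is the set of the i coordinates whose factor
   is an open unit interval, and c j in {0..<n} represents the class of the j-th corner
   coordinate in Z/nZ. *)
definition open_cubes :: "nat \<Rightarrow> nat \<Rightarrow> nat \<Rightarrow> (nat \<Rightarrow> real set) set set" where
  "open_cubes d n i =
     {(\<Pi>\<^sub>E j\<in>{..<d}. if j \<in> J then edge n (c j) else vertex n (c j)) | J c.
        J \<subseteq> {..<d} \<and> card J = i \<and> (\<forall>j<d. c j < n)}"

(* For k > i the truncated exponent is irrelevant, the binomial coefficient being 0. *)
definition cube_intrinsic_volume :: "nat \<Rightarrow> nat \<Rightarrow> real" where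
  "cube_intrinsic_volume i k = (-1) ^ (i - k) * real (i choose k)"

definition intrinsic_volume :: "nat \<Rightarrow> nat \<Rightarrow> nat \<Rightarrow> (nat \<Rightarrow> real set) set \<Rightarrow> real" where
  "intrinsic_volume d n k C =
     (\<Sum>i\<le>d. \<Sum>X\<in>{X \<in> open_cubes d n i. X \<subseteq> C}. cube_intrinsic_volume i k)"

definition voxel_pmf :: "nat \<Rightarrow> nat \<Rightarrow> real \<Rightarrow> ((nat \<Rightarrow> real set) set \<Rightarrow> bool) pmf" where
  "voxel_pmf d n p = Pi_pmf (open_cubes d n d) False (\<lambda>_. bernoulli_pmf p)"

definition voxel_complex ::
    "nat \<Rightarrow> nat \<Rightarrow> ((nat \<Rightarrow> real set) set \<Rightarrow> bool) \<Rightarrow> (nat \<Rightarrow> real set) set" where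
  "voxel_complex d n \<omega> = (\<Union>Y\<in>{Y \<in> open_cubes d n d. \<omega> Y}. torus d n closure_of Y)"

(* Finiteness matters: sums over infinite sets are 0 and Pi_pmf is only meaningful on a
   finite index set. *)
lemma finite_open_cubes: "finite (open_cubes d n i)"
proof (rule finite_subset)
  let ?F = "{..<d} \<rightarrow>\<^sub>E (edge n ` {..<n} \<union> vertex n ` {..<n})"
  show "finite ((\<lambda>F. PiE {..<d} F) ` ?F)"
    by (intro finite_imageI finite_PiE) auto
  show "open_cubes d n i \<subseteq> (\<lambda>F. PiE {..<d} F) ` ?F"
  proof
    fix X assume "X \<in> open_cubes d n i"
    then obtain J c where c: "\<forall>j<d. c j < n"
      and X: "X = (\<Pi>\<^sub>E j\<in>{..<d}. if j \<in> J then edge n (c j) else vertex n (c j))"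
      by (auto simp: open_cubes_def)
    let ?f = "\<lambda>j\<in>{..<d}. if j \<in> J then edge n (c j) else vertex n (c j)"
    have "X = PiE {..<d} ?f"
      unfolding X by (rule PiE_cong) simp
    moreover have "?f \<in> ?F"
      using c by (auto simp: PiE_iff)
    ultimately show "X \<in> (\<lambda>F. PiE {..<d} F) ` ?F"
      by blast
  qed
qed

end

theory Submission imports Defs begin

text \<open>
  A point x of the circle lies in a vertex, an open edge or a closed edge according to the
  floor of x modulo n and to whether x is an integer. Hence, coordinate by coordinate, an open
  i-cube is a face of exactly 2^(d - i) of the d-cubes, and it misses the voxel complex with
  probability q^(2^(d - i)). There are (d choose i) n^d open i-cubes, so linearity of expectation
  gives the sum of (-1)^(i - k) (d choose i) (i choose k) (1 - q^(2^(d - i))) over i; for k < d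
  the constant terms cancel, being an alternating sum of binomial coefficients.
\<close>

section \<open>Real representatives of points of the circle; vertices and open edges\<close>

lemma circle_proj_eq_iff:
  "circle_proj n x = circle_proj n y \<longleftrightarrow> (\<exists>m::int. x = y + of_int m * real n)"
proof
  assume "circle_proj n x = circle_proj n y"
  moreover have "x \<in> circle_proj n x"
    by (auto simp: circle_proj_def circle_rel_def intro: exI[of _ 0])
  ultimately show "\<exists>m::int. x = y + of_int m * real n"
    by (auto simp: circle_proj_def circle_rel_def algebra_simps)
next
  assume "\<exists>m::int. x = y + of_int m * real n"
  then obtain m :: int where m: "x = y + of_int m * real n" by blast
  have "(\<exists>l::int. z - x = of_int l * real n) \<longleftrightarrow> (\<exists>l::int. z - y = of_int l * real n)" for z
  proof
    assume "\<exists>l::int. z - x = of_int l * real n"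
    then obtain l :: int where "z - x = of_int l * real n" ..
    then show "\<exists>l::int. z - y = of_int l * real n"
      using m by (intro exI[of _ "l + m"]) (simp add: algebra_simps)
  next
    assume "\<exists>l::int. z - y = of_int l * real n"
    then obtain l :: int where "z - y = of_int l * real n" ..
    then show "\<exists>l::int. z - x = of_int l * real n"
      using m by (intro exI[of _ "l - m"]) (simp add: algebra_simps)
  qed
  then show "circle_proj n x = circle_proj n y"
    by (auto simp: circle_proj_def circle_rel_def)
qed

lemma of_int_eq_add_mult_div:
  fixes l :: int
  assumes "l mod int n = int a"
  shows "(of_int l :: real) = real a + of_int (l div int n) * real n"
proof -
  have "l = int a + (l div int n) * int n"
    using assms by (metis add.commute div_mult_mod_eq)
  then have "(of_int l :: real) = of_int (int a + (l div int n) * int n)" by metis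
  then show ?thesis by simp
qed

text \<open>Adding a multiple of \<open>n\<close> preserves integrality and the floor modulo
  \<open>n\<close>, so both are well defined on the circle and can be read off any
  representative.\<close>

lemma circle_proj_in_vertex_iff:
  assumes "a < n"
  shows "circle_proj n x \<in> vertex n a \<longleftrightarrow> x \<in> \<int> \<and> \<lfloor>x\<rfloor> mod int n = int a"
proof
  assume "circle_proj n x \<in> vertex n a"
  then obtain m :: int where "x = real a + of_int m * real n"
    by (auto simp: vertex_def circle_proj_eq_iff)
  then have "x = of_int (int a + m * int n)" by simp
  then show "x \<in> \<int> \<and> \<lfloor>x\<rfloor> mod int n = int a"
    using assms by (simp only: floor_of_int) simp
next
  assume x: "x \<in> \<int> \<and> \<lfloor>x\<rfloor> mod int n = int a"
  then have "x = real a + of_int (\<lfloor>x\<rfloor> div int n) * real n"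
    using of_int_eq_add_mult_div[of "\<lfloor>x\<rfloor>" n a] by (auto elim: Ints_cases)
  then show "circle_proj n x \<in> vertex n a"
    by (auto simp: vertex_def circle_proj_eq_iff)
qed

lemma circle_proj_in_edge_iff:
  assumes "a < n"
  shows "circle_proj n x \<in> edge n a \<longleftrightarrow> x \<notin> \<int> \<and> \<lfloor>x\<rfloor> mod int n = int a"
proof
  assume "circle_proj n x \<in> edge n a"
  then obtain y where y: "real a < y" "y < real a + 1" "circle_proj n x = circle_proj n y"
    by (auto simp: edge_def)
  then obtain m :: int where "x = y + of_int m * real n"
    by (auto simp: circle_proj_eq_iff)
  note y = y(1,2) this
  \<comment> \<open>\<open>x\<close> lies strictly between the integers \<open>a + m * n\<close> and
    \<open>a + m * n + 1\<close>; strictness on the left then rules out that \<open>x\<close> is an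
    integer.\<close>
  then have fl: "\<lfloor>x\<rfloor> = int a + m * int n"
    by (intro floor_unique) auto
  have "x \<notin> \<int>"
  proof
    assume "x \<in> \<int>"
    then have "x = of_int \<lfloor>x\<rfloor>" by (auto elim: Ints_cases)
    with fl y show False by simp
  qed
  then show "x \<notin> \<int> \<and> \<lfloor>x\<rfloor> mod int n = int a"
    using assms fl by simp
next
  assume x: "x \<notin> \<int> \<and> \<lfloor>x\<rfloor> mod int n = int a"
  \<comment> \<open>The representative in the unit interval starting at \<open>a\<close>:
    subtracting this multiple of \<open>n\<close> moves the floor of \<open>x\<close> to
    \<open>a\<close>.\<close>
  define y where "y = x - of_int (\<lfloor>x\<rfloor> div int n) * real n"
  have fl: "of_int \<lfloor>x\<rfloor> = real a + of_int (\<lfloor>x\<rfloor> div int n) * real n"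
    using x of_int_eq_add_mult_div[of "\<lfloor>x\<rfloor>" n a] by simp
  have "of_int \<lfloor>x\<rfloor> \<noteq> x" using x Ints_of_int by metis
  then have "of_int \<lfloor>x\<rfloor> < x" "x < of_int \<lfloor>x\<rfloor> + 1"
    using of_int_floor_le[of x] by linarith+
  then have "y \<in> {real a <..< real a + 1}"
    using fl by (simp add: y_def)
  moreover have "circle_proj n x = circle_proj n y"
    unfolding circle_proj_eq_iff y_def by (rule exI[of _ "\<lfloor>x\<rfloor> div int n"]) simp
  ultimately show "circle_proj n x \<in> edge n a"
    by (auto simp: edge_def)
qed

section \<open>Closed arcs and the closure of an edge\<close>

lemma circle_proj_in_arc_iff:
  "circle_proj n x \<in> circle_proj n ` {r..s} \<longleftrightarrow>
    (\<exists>m::int. r + of_int m * real n \<le> x \<and> x \<le> s + of_int m * real n)"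
proof
  assume "circle_proj n x \<in> circle_proj n ` {r..s}"
  then obtain y where y: "r \<le> y" "y \<le> s" and "circle_proj n x = circle_proj n y" by auto
  then obtain m :: int where "x = y + of_int m * real n"
    by (auto simp: circle_proj_eq_iff)
  with y show "\<exists>m::int. r + of_int m * real n \<le> x \<and> x \<le> s + of_int m * real n"
    by (intro exI[of _ m]) simp
next
  assume "\<exists>m::int. r + of_int m * real n \<le> x \<and> x \<le> s + of_int m * real n"
  then obtain m :: int where "r + of_int m * real n \<le> x" "x \<le> s + of_int m * real n" by blast
  then have "x - of_int m * real n \<in> {r..s}" by simp
  moreover have "circle_proj n x = circle_proj n (x - of_int m * real n)"
    unfolding circle_proj_eq_iff by (rule exI[of _ m]) simp
  ultimately show "circle_proj n x \<in> circle_proj n ` {r..s}" by blast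
qed

text \<open>In the quotient topology closedness is tested on the preimage in the reals. The
  complement of that preimage is the union of the (possibly empty) open gaps between consecutive
  translates of \<open>{r..s}\<close> by multiples of \<open>n\<close>.\<close>

lemma closedin_circle_arc:
  assumes "0 < n"
  shows "closedin (circle n) (circle_proj n ` {r..s})"
proof -
  let ?K = "circle_proj n ` {r..s}"
  have "- (circle_proj n -` ?K) = (\<Union>m::int. {s + of_int m * real n <..< r + of_int (m + 1) * real n})"
    (is "?L = ?R")
  proof (intro equalityI subsetI)
    fix x assume "x \<in> ?L"
    then have nx: "\<not> (r + of_int m * real n \<le> x \<and> x \<le> s + of_int m * real n)" for m :: int
      by (auto simp: circle_proj_in_arc_iff)
    \<comment> \<open>The last translate starting at or before \<open>x\<close>. As \<open>x\<close>
      is not in it, \<open>x\<close> lies beyond its right end and before the start of the next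
      one.\<close>
    define m where "m = \<lfloor>(x - r) / real n\<rfloor>"
    have "of_int m \<le> (x - r) / real n" "(x - r) / real n < of_int m + 1"
      unfolding m_def by linarith+
    then have "of_int m * real n \<le> x - r" "x - r < (of_int m + 1) * real n"
      using assms by (simp_all add: pos_le_divide_eq pos_divide_less_eq)
    with nx[of m] have "x \<in> {s + of_int m * real n <..< r + of_int (m + 1) * real n}"
      by (auto simp: algebra_simps)
    then show "x \<in> ?R" by blast
  next
    fix x assume "x \<in> ?R"
    then obtain m :: int
      where m: "s + of_int m * real n < x" "x < r + of_int (m + 1) * real n" by auto
    have False if l: "r + of_int l * real n \<le> x" "x \<le> s + of_int l * real n" for l :: int
    proof -
      have "of_int m * real n < of_int l * real n" "of_int l * real n < of_int (m + 1) * real n"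
        using m l by linarith+
      then have "m < l" "l < m + 1"
        using assms by (simp_all only: mult_less_cancel_right_pos of_nat_0_less_iff of_int_less_iff)
      then show False by linarith
    qed
    then show "x \<in> ?L"
      by (auto simp only: Compl_iff vimage_eq circle_proj_in_arc_iff)
  qed
  then have "open (- (circle_proj n -` ?K))" by auto
  moreover have "circle_proj n -` (topspace (circle n) - ?K) = - (circle_proj n -` ?K)"
    by (auto simp: topspace_circle circle_proj_in_quotient)
  ultimately show ?thesis
    by (auto simp: closedin_def openin_circle topspace_circle circle_proj_in_quotient)
qed

text \<open>The closed arc is closed and contains the edge. Conversely, a neighbourhood of one of
  its points pulls back to an open set of reals, which meets the open interval because that is dense
  in the closed one.\<close>

lemma closure_of_edge:
  assumes "0 < n"
  shows "circle n closure_of edge n a = circle_proj n ` {real a..real a + 1}"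
proof
  show "circle n closure_of edge n a \<subseteq> circle_proj n ` {real a..real a + 1}"
    unfolding edge_def by (intro closure_of_minimal closedin_circle_arc assms image_mono) auto
  show "circle_proj n ` {real a..real a + 1} \<subseteq> circle n closure_of edge n a"
  proof (clarify, unfold in_closure_of, intro conjI allI impI)
    fix x U assume x: "x \<in> {real a..real a + 1}" and U: "circle_proj n x \<in> U \<and> openin (circle n) U"
    have "x \<in> closure {real a <..< real a + 1}" using x by simp
    moreover have "open (circle_proj n -` U)" "x \<in> circle_proj n -` U"
      using U by (auto simp: openin_circle)
    ultimately have "circle_proj n -` U \<inter> {real a <..< real a + 1} \<noteq> {}"
      by (metis IntI emptyE open_Int_closure_eq_empty)
    then show "\<exists>y. y \<in> edge n a \<and> y \<in> U" by (auto simp: edge_def)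
  qed (simp add: topspace_circle circle_proj_in_quotient)
qed

text \<open>The second alternative accounts for the right end point \<open>a + 1\<close>, an integer
  whose floor is one too large.\<close>

lemma circle_proj_in_closure_of_edge_iff:
  assumes "a < n"
  shows "circle_proj n x \<in> circle n closure_of edge n a \<longleftrightarrow>
    \<lfloor>x\<rfloor> mod int n = int a \<or> x \<in> \<int> \<and> (\<lfloor>x\<rfloor> - 1) mod int n = int a"
proof -
  have "{real a..real a + 1} = insert (real a + 1) (insert (real a) {real a <..< real a + 1})"
    by auto
  then have "circle n closure_of edge n a = vertex n a \<union> edge n a \<union> {circle_proj n (real a + 1)}"
    using closure_of_edge[of n a] assms by (simp add: edge_def vertex_def image_Un)
  moreover have "circle_proj n x = circle_proj n (real a + 1) \<longleftrightarrow> circle_proj n (x - 1) \<in> vertex n a"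
    by (auto simp: vertex_def circle_proj_eq_iff algebra_simps)
  moreover have "x - 1 \<in> \<int> \<longleftrightarrow> x \<in> \<int>"
    by (metis Ints_1 Ints_add Ints_diff diff_add_cancel)
  moreover have "\<lfloor>x - 1\<rfloor> = \<lfloor>x\<rfloor> - 1" by linarith
  ultimately show ?thesis
    using assms by (auto simp: circle_proj_in_vertex_iff circle_proj_in_edge_iff)
qed

section \<open>Cells of the circle and their incidence with edges\<close>

definition cell :: "nat \<Rightarrow> bool \<Rightarrow> nat \<Rightarrow> real set set" where
  "cell n b a = (if b then edge n a else vertex n a)"

lemma circle_proj_in_cell_iff:
  assumes "a < n"
  shows "circle_proj n x \<in> cell n b a \<longleftrightarrow> (x \<in> \<int> \<longleftrightarrow> \<not> b) \<and> \<lfloor>x\<rfloor> mod int n = int a"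
  using assms by (auto simp: cell_def circle_proj_in_vertex_iff circle_proj_in_edge_iff)

lemma cell_nonempty: "cell n b a \<noteq> {}"
  by (simp add: cell_def edge_def vertex_def)

lemma cell_elemE:
  assumes "z \<in> cell n b a"
  obtains x where "z = circle_proj n x"
  using assms by (auto simp: cell_def edge_def vertex_def split: if_splits)

text \<open>Integrality of a representative recovers the kind of the cell, and its floor modulo
  \<open>n\<close> the position; distinct cells are therefore disjoint.\<close>

lemma cell_inj:
  assumes "z \<in> cell n b a" "z \<in> cell n b' a'" "a < n" "a' < n"
  shows "b = b' \<and> a = a'"
proof -
  obtain x where "z = circle_proj n x" using assms(1) by (rule cell_elemE)
  with assms show ?thesis by (auto simp: circle_proj_in_cell_iff)
qed

text \<open>The predecessor of a modulo n is written with n - 1 added, since a - 1 is truncated at a = 0.\<close>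
definition incident_edges :: "nat \<Rightarrow> bool \<Rightarrow> nat \<Rightarrow> nat set" where
  "incident_edges n b a = (if b then {a} else {a, (a + (n - 1)) mod n})"

lemma incident_edges_subset: "a < n \<Longrightarrow> incident_edges n b a \<subseteq> {..<n}"
  by (auto simp: incident_edges_def)

text \<open>The hypothesis \<open>2 \<le> n\<close> makes the two edges at a vertex distinct; for
  \<open>n = 1\<close> they would be the same edge.\<close>

lemma card_incident_edges:
  assumes "a < n" "2 \<le> n"
  shows "card (incident_edges n b a) = (if b then 1 else 2)"
proof -
  have "(a + (n - 1)) mod n \<noteq> a"
  proof (cases "a = 0")
    case False
    then have "(a + (n - 1)) mod n = (a - 1 + n) mod n"
      using assms by (intro arg_cong[where f = "\<lambda>b. b mod n"]) linarith
    also have "\<dots> = a - 1" using assms by simp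
    finally show ?thesis using False by simp
  qed (use assms in auto)
  then show ?thesis by (simp add: incident_edges_def)
qed

text \<open>The right-hand side does not mention \<open>z\<close>: the closure of an edge contains a
  whole cell as soon as it contains one of its points.\<close>

lemma in_closure_of_edge_iff:
  assumes "z \<in> cell n b c" "a < n" "c < n"
  shows "z \<in> circle n closure_of edge n a \<longleftrightarrow> a \<in> incident_edges n b c"
proof -
  obtain x where x: "z = circle_proj n x" using assms(1) by (rule cell_elemE)
  have c: "\<lfloor>x\<rfloor> mod int n = int c" and b: "x \<in> \<int> \<longleftrightarrow> \<not> b"
    using assms by (auto simp: x circle_proj_in_cell_iff)
  \<comment> \<open>\<open>n - 1\<close> is not truncated because \<open>c < n\<close>; modulo
    \<open>n\<close>, adding it amounts to subtracting 1.\<close>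
  have "int ((c + (n - 1)) mod n) = (int c + (int n - 1)) mod int n"
    using assms by (simp add: zmod_int of_nat_diff add_diff_eq)
  also have "\<dots> = (int c - 1) mod int n"
    by (metis add_diff_eq diff_add_eq mod_add_self2)
  also have "\<dots> = (\<lfloor>x\<rfloor> - 1) mod int n"
    unfolding c[symmetric] by (simp add: mod_diff_left_eq)
  finally have "(\<lfloor>x\<rfloor> - 1) mod int n = int a \<longleftrightarrow> a = (c + (n - 1)) mod n" by linarith
  then show ?thesis
    using assms(2) b c by (auto simp: x circle_proj_in_closure_of_edge_iff incident_edges_def)
qed

section \<open>Coding and counting the open cubes\<close>

definition cube :: "nat \<Rightarrow> nat \<Rightarrow> nat set \<Rightarrow> (nat \<Rightarrow> nat) \<Rightarrow> (nat \<Rightarrow> real set) set" where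
  "cube d n J c = (\<Pi>\<^sub>E j\<in>{..<d}. cell n (j \<in> J) (c j))"

lemma cube_elem_ex: "\<exists>z. z \<in> cube d n J c"
proof -
  have "cube d n J c \<noteq> {}"
    unfolding cube_def PiE_eq_empty_iff by (simp add: cell_nonempty)
  then show ?thesis by (simp add: ex_in_conv)
qed

text \<open>A single common point of two cubes already determines \<open>J\<close> and
  \<open>c\<close> coordinate by coordinate, by \<open>cell_inj\<close>.\<close>

lemma inj_on_cube:
  "inj_on (\<lambda>(J, c). cube d n J c) (Pow {..<d} \<times> ({..<d} \<rightarrow>\<^sub>E {..<n}))"
proof (rule inj_onI, clarify)
  fix J c J' c'
  assume J: "J \<subseteq> {..<d}" "J' \<subseteq> {..<d}"
    and c: "c \<in> {..<d} \<rightarrow>\<^sub>E {..<n}" "c' \<in> {..<d} \<rightarrow>\<^sub>E {..<n}"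
    and eq: "cube d n J c = cube d n J' c'"
  obtain z where z: "z \<in> cube d n J c" using cube_elem_ex by blast
  have "(j \<in> J) = (j \<in> J') \<and> c j = c' j" if "j < d" for j
  proof (rule cell_inj)
    show "z j \<in> cell n (j \<in> J) (c j)" using z that by (auto simp: cube_def)
    show "z j \<in> cell n (j \<in> J') (c' j)" using z that unfolding eq by (auto simp: cube_def)
  qed (use c that in auto)
  then show "J = J' \<and> c = c'"
    using J c by (auto intro!: PiE_ext[OF c])
qed

text \<open>In \<open>open_cubes\<close> the values of \<open>c\<close> off \<open>{..<d}\<close>
  are arbitrary. Extensional functions remove this freedom, so that the index set is finite, the
  coding injective, and cubes can be counted.\<close>

lemma open_cubes_eq_image:
  "open_cubes d n i =
    (\<lambda>(J, c). cube d n J c) ` ({J. J \<subseteq> {..<d} \<and> card J = i} \<times> ({..<d} \<rightarrow>\<^sub>E {..<n}))"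
  (is "_ = ?R")
proof
  show "?R \<subseteq> open_cubes d n i"
  proof clarify
    fix J c assume "J \<subseteq> {..<d}" "i = card J" "c \<in> {..<d} \<rightarrow>\<^sub>E {..<n}"
    then show "cube d n J c \<in> open_cubes d n (card J)"
      unfolding open_cubes_def cube_def cell_def
      by (intro CollectI exI[of _ J] exI[of _ c]) auto
  qed
  show "open_cubes d n i \<subseteq> ?R"
  proof
    fix X assume "X \<in> open_cubes d n i"
    then obtain J c where J: "J \<subseteq> {..<d}" "card J = i" and c: "\<forall>j<d. c j < n"
      and X: "X = (\<Pi>\<^sub>E j\<in>{..<d}. if j \<in> J then edge n (c j) else vertex n (c j))"
      by (auto simp: open_cubes_def)
    have "X = cube d n J (restrict c {..<d})"
      unfolding X cube_def by (rule PiE_cong) (simp add: cell_def)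
    moreover have "restrict c {..<d} \<in> {..<d} \<rightarrow>\<^sub>E {..<n}" using c by auto
    ultimately show "X \<in> ?R" using J by (intro image_eqI[of _ _ "(J, restrict c {..<d})"]) auto
  qed
qed

lemma card_open_cubes: "card (open_cubes d n i) = (d choose i) * n ^ d"
proof -
  have "inj_on (\<lambda>(J, c). cube d n J c)
      ({J. J \<subseteq> {..<d} \<and> card J = i} \<times> ({..<d} \<rightarrow>\<^sub>E {..<n}))"
    by (rule inj_on_subset[OF inj_on_cube]) auto
  then show ?thesis
    by (simp add: open_cubes_eq_image card_image card_cartesian_product n_subsets card_PiE)
qed

lemma open_cubes_top:
  "open_cubes d n d = cube d n {..<d} ` ({..<d} \<rightarrow>\<^sub>E {..<n})"
proof -
  have "{J. J \<subseteq> {..<d} \<and> card J = d} = {{..<d}}"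
    using card_subset_eq[of "{..<d}"] by auto
  then show ?thesis by (auto simp: open_cubes_eq_image)
qed

section \<open>Closures of top cubes and cofaces\<close>

lemma closure_of_cube:
  "torus d n closure_of cube d n {..<d} c = (\<Pi>\<^sub>E j\<in>{..<d}. circle n closure_of edge n (c j))"
proof -
  have "cube d n {..<d} c = (\<Pi>\<^sub>E j\<in>{..<d}. edge n (c j))"
    unfolding cube_def by (rule PiE_cong) (simp add: cell_def)
  then show ?thesis by (simp add: torus_def closure_of_product_topology)
qed

lemma in_closure_of_cube_iff:
  assumes "z \<in> cube d n J c" "c \<in> {..<d} \<rightarrow>\<^sub>E {..<n}" "a \<in> {..<d} \<rightarrow>\<^sub>E {..<n}"
  shows "z \<in> torus d n closure_of cube d n {..<d} a \<longleftrightarrow>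
    a \<in> (\<Pi>\<^sub>E j\<in>{..<d}. incident_edges n (j \<in> J) (c j))"
proof -
  have "z j \<in> circle n closure_of edge n (a j) \<longleftrightarrow> a j \<in> incident_edges n (j \<in> J) (c j)"
    if "j < d" for j
    using that assms by (intro in_closure_of_edge_iff) (auto simp: cube_def)
  with assms show ?thesis
    unfolding closure_of_cube by (auto simp: cube_def PiE_iff)
qed

definition cofaces :: "nat \<Rightarrow> nat \<Rightarrow> (nat \<Rightarrow> real set) set \<Rightarrow> (nat \<Rightarrow> real set) set set" where
  "cofaces d n X = {Y \<in> open_cubes d n d. X \<subseteq> torus d n closure_of Y}"

text \<open>By \<open>in_closure_of_cube_iff\<close>, whether a point of \<open>X\<close> lies in
  the closure of \<open>Y\<close> depends only on the codes of the two cubes, so one point decides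
  for all of \<open>X\<close>.\<close>

lemma subset_closure_of_cube_iff:
  assumes "X \<in> open_cubes d n i" "Y \<in> open_cubes d n d" "z \<in> X"
  shows "X \<subseteq> torus d n closure_of Y \<longleftrightarrow> z \<in> torus d n closure_of Y"
proof -
  obtain J c where c: "c \<in> {..<d} \<rightarrow>\<^sub>E {..<n}" and X: "X = cube d n J c"
    using assms(1) by (auto simp: open_cubes_eq_image)
  obtain a where a: "a \<in> {..<d} \<rightarrow>\<^sub>E {..<n}" and Y: "Y = cube d n {..<d} a"
    using assms(2) by (auto simp: open_cubes_top)
  show ?thesis
    using assms(3) in_closure_of_cube_iff[OF _ c a] by (auto simp: X Y)
qed

text \<open>A union of closures might cover \<open>X\<close> without any one of them containing it.
  This cannot happen here: the closure through one point of \<open>X\<close> contains all of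
  \<open>X\<close>. Containment thus becomes an event about the selection of the cofaces
  only.\<close>

lemma subset_voxel_complex_iff:
  assumes "X \<in> open_cubes d n i"
  shows "X \<subseteq> voxel_complex d n \<omega> \<longleftrightarrow> (\<exists>Y\<in>cofaces d n X. \<omega> Y)"
proof -
  obtain J c where "X = cube d n J c"
    using assms by (auto simp: open_cubes_eq_image)
  then obtain z where z: "z \<in> X"
    using cube_elem_ex by blast
  show ?thesis
  proof
    assume "X \<subseteq> voxel_complex d n \<omega>"
    with z obtain Y where "Y \<in> open_cubes d n d" "\<omega> Y" "z \<in> torus d n closure_of Y"
      by (auto simp: voxel_complex_def)
    with subset_closure_of_cube_iff[OF assms _ z] show "\<exists>Y\<in>cofaces d n X. \<omega> Y"
      by (intro bexI[of _ Y]) (simp_all add: cofaces_def)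
  next
    assume "\<exists>Y\<in>cofaces d n X. \<omega> Y"
    then obtain Y where "Y \<in> open_cubes d n d" "\<omega> Y" "X \<subseteq> torus d n closure_of Y"
      by (auto simp: cofaces_def)
    then show "X \<subseteq> voxel_complex d n \<omega>"
      unfolding voxel_complex_def by (intro SUP_upper2[of Y]) simp_all
  qed
qed

text \<open>The codes of the cofaces form a product of sets \<open>incident_edges\<close>, with one
  choice for each of the \<open>i\<close> interval factors and two for each of the
  \<open>d - i\<close> point factors.\<close>

lemma card_cofaces:
  assumes "X \<in> open_cubes d n i" "2 \<le> n"
  shows "card (cofaces d n X) = 2 ^ (d - i)"
proof -
  obtain J c where J: "J \<subseteq> {..<d}" "card J = i"
    and c: "c \<in> {..<d} \<rightarrow>\<^sub>E {..<n}" and X: "X = cube d n J c"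
    using assms(1) by (auto simp: open_cubes_eq_image)
  let ?A = "\<Pi>\<^sub>E j\<in>{..<d}. incident_edges n (j \<in> J) (c j)"
  obtain z where z: "z \<in> X" using X cube_elem_ex by blast
  have sub: "?A \<subseteq> {..<d} \<rightarrow>\<^sub>E {..<n}"
    using c by (intro PiE_mono incident_edges_subset) auto
  have "cofaces d n X = {Y \<in> open_cubes d n d. z \<in> torus d n closure_of Y}"
    using subset_closure_of_cube_iff[OF assms(1) _ z] by (auto simp: cofaces_def)
  also have "\<dots> = cube d n {..<d} ` ?A"
    using in_closure_of_cube_iff[OF z[unfolded X] c] sub by (auto simp: open_cubes_top)
  finally have "cofaces d n X = cube d n {..<d} ` ?A" .
  moreover have "inj_on (cube d n {..<d}) ?A"
  proof (rule inj_onI)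
    fix a b assume ab: "a \<in> ?A" "b \<in> ?A" "cube d n {..<d} a = cube d n {..<d} b"
    then have "({..<d}, a) = ({..<d}, b)"
      using sub by (intro inj_onD[OF inj_on_cube[of d n]]) auto
    then show "a = b" by simp
  qed
  ultimately have "card (cofaces d n X) = (\<Prod>j<d. card (incident_edges n (j \<in> J) (c j)))"
    by (simp add: card_image card_PiE)
  also have "\<dots> = (\<Prod>j<d. if j \<in> J then 1 else 2)"
  proof (rule prod.cong)
    fix j assume "j \<in> {..<d}"
    with c have "c j < n" by auto
    with assms(2) show "card (incident_edges n (j \<in> J) (c j)) = (if j \<in> J then 1 else 2)"
      by (simp add: card_incident_edges)
  qed simp
  also have "\<dots> = (\<Prod>j\<in>{..<d} - J. 2)"
    by (intro prod.mono_neutral_cong_right) auto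
  also have "\<dots> = 2 ^ (d - i)"
    using J by (simp add: card_Diff_subset finite_subset)
  finally show ?thesis .
qed

section \<open>Probabilities and the expected intrinsic volume\<close>

lemma prob_subset_voxel_complex:
  assumes "X \<in> open_cubes d n i" "2 \<le> n" "p \<in> {0..1}"
  shows "measure_pmf.prob (voxel_pmf d n p) {\<omega>. X \<subseteq> voxel_complex d n \<omega>}
    = 1 - (1 - p) ^ (2 ^ (d - i))"
proof -
  let ?N = "cofaces d n X" and ?D = "open_cubes d n d"
  \<comment> \<open>The event that no coface is selected is written as a product set, unconstrained
    outside \<open>?N\<close>, so that independence turns its probability into a product.\<close>
  let ?B = "\<lambda>Y. if Y \<in> ?N then {False} else UNIV"
  have sub: "?N \<subseteq> ?D" by (auto simp: cofaces_def)
  have "Pi ?D ?B = {\<omega>. \<forall>Y\<in>?N. \<not> \<omega> Y}"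
  proof (intro equalityI subsetI)
    fix \<omega> assume \<omega>: "\<omega> \<in> Pi ?D ?B"
    have "\<not> \<omega> Y" if "Y \<in> ?N" for Y
      using Pi_mem[OF \<omega>, of Y] that sub by auto
    then show "\<omega> \<in> {\<omega>. \<forall>Y\<in>?N. \<not> \<omega> Y}" by simp
  qed (simp add: Pi_iff)
  moreover have "{\<omega>. X \<subseteq> voxel_complex d n \<omega>} = {\<omega>. \<exists>Y\<in>?N. \<omega> Y}"
    by (rule Collect_cong) (rule subset_voxel_complex_iff[OF assms(1)])
  moreover have "{\<omega>. \<exists>Y\<in>?N. \<omega> Y} = UNIV - {\<omega>. \<forall>Y\<in>?N. \<not> \<omega> Y}"
    by blast
  ultimately have "{\<omega>. X \<subseteq> voxel_complex d n \<omega>} = UNIV - Pi ?D ?B"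
    by (simp only:)
  moreover have "measure_pmf.prob (voxel_pmf d n p) (Pi ?D ?B) = (1 - p) ^ (2 ^ (d - i))"
  proof -
    have "measure_pmf.prob (voxel_pmf d n p) (Pi ?D ?B)
        = (\<Prod>Y\<in>?D. measure_pmf.prob (bernoulli_pmf p) (?B Y))"
      unfolding voxel_pmf_def by (rule measure_Pi_pmf_Pi) (rule finite_open_cubes)
    \<comment> \<open>The top cubes that are not cofaces contribute factors
      \<open>prob UNIV = 1\<close>.\<close>
    also have "\<dots> = (\<Prod>Y\<in>?N. 1 - p)"
      using sub assms(3) finite_open_cubes
      by (intro prod.mono_neutral_cong_right) (auto simp: measure_pmf_single)
    finally show ?thesis using card_cofaces[OF assms(1,2)] by simp
  qed
  ultimately show ?thesis
    using measure_pmf.prob_compl[of "Pi ?D ?B" "voxel_pmf d n p"] by simp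
qed

lemma expectation_intrinsic_volume:
  assumes "2 \<le> n" "p \<in> {0..1}"
  shows "measure_pmf.expectation (voxel_pmf d n p)
      (\<lambda>\<omega>. intrinsic_volume d n k (voxel_complex d n \<omega>))
    = real n ^ d * (\<Sum>i\<le>d. cube_intrinsic_volume i k * real (d choose i) * (1 - (1 - p) ^ (2 ^ (d - i))))"
proof -
  let ?M = "measure_pmf (voxel_pmf d n p)"
  let ?S = "\<lambda>X. {\<omega>. X \<subseteq> voxel_complex d n \<omega>}"
  \<comment> \<open>Indicators replace the random range of summation by a fixed finite one, to which
    linearity of expectation applies.\<close>
  have "intrinsic_volume d n k (voxel_complex d n \<omega>)
      = (\<Sum>i\<le>d. \<Sum>X\<in>open_cubes d n i. cube_intrinsic_volume i k * indicator (?S X) \<omega>)" for \<omega>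
    unfolding intrinsic_volume_def
    by (intro sum.cong sum.mono_neutral_cong_left) (auto simp: finite_open_cubes indicator_def)
  then have "integral\<^sup>L ?M (\<lambda>\<omega>. intrinsic_volume d n k (voxel_complex d n \<omega>))
      = (\<Sum>i\<le>d. \<Sum>X\<in>open_cubes d n i. cube_intrinsic_volume i k * measure ?M (?S X))"
    by (simp add: measure_pmf.emeasure_finite less_top[symmetric])
  also have "\<dots> = (\<Sum>i\<le>d. \<Sum>X\<in>open_cubes d n i.
      cube_intrinsic_volume i k * (1 - (1 - p) ^ (2 ^ (d - i))))"
    using assms by (intro sum.cong) (auto simp: prob_subset_voxel_complex)
  also have "\<dots> = real n ^ d *
      (\<Sum>i\<le>d. cube_intrinsic_volume i k * real (d choose i) * (1 - (1 - p) ^ (2 ^ (d - i))))"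
    by (simp add: card_open_cubes sum_distrib_left mult_ac)
  finally show ?thesis .
qed

section \<open>Binomial sums and the degree of the polynomial\<close>

lemma alternating_sum_choose_mult:
  assumes "k < d"
  shows "(\<Sum>i=k..d. (-1) ^ (i - k) * real (d choose i) * real (i choose k)) = 0"
proof -
  \<comment> \<open>The identity \<open>(d choose i) * (i choose k) = (d choose k) * ((d - k) choose
    (i - k))\<close> isolates an alternating row sum, which vanishes because
    \<open>d - k > 0\<close>.\<close>
  have "(\<Sum>i=k..d. (-1) ^ (i - k) * real (d choose i) * real (i choose k))
      = (\<Sum>i=k..d. real (d choose k) * ((-1) ^ (i - k) * real ((d - k) choose (i - k))))"
    by (intro sum.cong) (simp_all add: choose_mult mult.assoc flip: of_nat_mult)
  also have "\<dots> = real (d choose k) * (\<Sum>j\<le>d - k. (-1) ^ j * real ((d - k) choose j))"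
    unfolding sum_distrib_left
    by (rule sum.reindex_bij_witness[of _ "\<lambda>j. j + k" "\<lambda>i. i - k"]) (use assms in auto)
  also have "\<dots> = 0"
    using choose_alternating_sum[of "d - k", where ?'a = real] assms by simp
  finally show ?thesis .
qed

lemma sum_cube_intrinsic_volume:
  assumes "k \<le> d"
  shows "(\<Sum>i\<le>d. cube_intrinsic_volume i k * real (d choose i) * (1 - q ^ (2 ^ (d - i))))
    = (if k < d
       then \<Sum>i=k..d. (-1) ^ (i - k + 1) * real (d choose i) * real (i choose k) * q ^ (2 ^ (d - i))
       else 1 - q)"
proof -
  let ?t = "\<lambda>i. (-1) ^ (i - k) * real (d choose i) * real (i choose k)"
  \<comment> \<open>For \<open>i < k\<close> the binomial \<open>i choose k\<close> is 0, so
    dropping these terms also disposes of the truncated exponent \<open>i - k\<close>.\<close>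
  have *: "(\<Sum>i\<le>d. cube_intrinsic_volume i k * real (d choose i) * (1 - q ^ (2 ^ (d - i))))
      = (\<Sum>i=k..d. ?t i * (1 - q ^ (2 ^ (d - i))))"
    by (rule sum.mono_neutral_cong_right) (auto simp: cube_intrinsic_volume_def)
  show ?thesis
  proof (cases "k < d")
    case True
    \<comment> \<open>The constant 1 in each factor yields the vanishing alternating sum; the minus
      sign left over accounts for the exponent \<open>i - k + 1\<close>.\<close>
    have "(\<Sum>i=k..d. ?t i * (1 - q ^ (2 ^ (d - i))))
        = (\<Sum>i=k..d. ?t i) + (\<Sum>i=k..d. - ?t i * q ^ (2 ^ (d - i)))"
      unfolding sum.distrib[symmetric] by (rule sum.cong) (auto simp: algebra_simps)
    with True show ?thesis
      by (simp add: * alternating_sum_choose_mult)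
  next
    case False
    with assms have "k = d" by simp
    with * show ?thesis by simp
  qed
qed

lemma expected_volume_poly:
  fixes d k :: nat
  assumes "k < d"
  defines "E \<equiv> \<Sum>i=k..d. monom ((-1) ^ (i - k + 1) * real (d choose i) * real (i choose k)) (2 ^ (d - i))"
  shows "degree E = 2 ^ (d - k)"
    and "poly E q = (\<Sum>i=k..d. (-1) ^ (i - k + 1) * real (d choose i) * real (i choose k) * q ^ (2 ^ (d - i)))"
proof -
  let ?a = "\<lambda>i. (-1) ^ (i - k + 1) * real (d choose i) * real (i choose k)"
  show "poly E q = (\<Sum>i=k..d. ?a i * q ^ (2 ^ (d - i)))"
    by (simp add: E_def poly_sum poly_monom)
  have "degree E \<le> 2 ^ (d - k)"
    unfolding E_def
    by (intro degree_sum_le) (auto intro!: order_trans[OF degree_monom_le] power_increasing)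
  \<comment> \<open>For \<open>i > k\<close> the exponent \<open>2 ^ (d - i)\<close> is strictly
    smaller, so only \<open>i = k\<close> contributes, with the nonzero coefficient
    \<open>-(d choose k)\<close>.\<close>
  moreover have "coeff E (2 ^ (d - k)) = (\<Sum>i=k..d. if i = k then ?a i else 0)"
    unfolding E_def coeff_sum by (intro sum.cong) auto
  then have "coeff E (2 ^ (d - k)) \<noteq> 0"
    using assms by simp
  ultimately show "degree E = 2 ^ (d - k)"
    by (intro antisym le_degree)
qed

text \<open>\<open>E\<close> is chosen before \<open>n\<close> and \<open>p\<close>, so one
  polynomial serves all lattice sizes and all probabilities, and the degree is that of an actual
  polynomial rather than of a function on \<open>{0..1}\<close>.\<close>

theorem theorem3:
  fixes d k :: nat
  assumes "k \<le> d"
  shows "\<exists>E :: real poly.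
    degree E = 2 ^ (d - k) \<and>
    (\<forall>q. poly E q =
       (if k < d
        then \<Sum>i=k..d. (-1) ^ (i - k + 1) * real (d choose i) * real (i choose k) * q ^ (2 ^ (d - i))
        else 1 - q)) \<and>
    (\<forall>n::nat. \<forall>p\<in>{0..1}. n \<ge> 2 \<longrightarrow>
       1 / real n ^ d *
         measure_pmf.expectation (voxel_pmf d n p) (\<lambda>\<omega>. intrinsic_volume d n k (voxel_complex d n \<omega>))
       = poly E (1 - p))"
proof -
  let ?f = "\<lambda>q. if k < d
      then \<Sum>i=k..d. (-1) ^ (i - k + 1) * real (d choose i) * real (i choose k) * q ^ (2 ^ (d - i))
      else 1 - q"
  obtain E :: "real poly" where E: "degree E = 2 ^ (d - k)" "\<And>q. poly E q = ?f q"
  proof (cases "k < d")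
    case True
    with expected_volume_poly[OF True] show ?thesis by (intro that) simp_all
  next
    case False
    \<comment> \<open>Here \<open>k = d\<close>: the polynomial \<open>1 - q\<close> has degree 1,
      which is \<open>2 ^ 0\<close>.\<close>
    with assms show ?thesis by (intro that[of "[:1, -1:]"]) simp_all
  qed
  have "1 / real n ^ d *
      measure_pmf.expectation (voxel_pmf d n p) (\<lambda>\<omega>. intrinsic_volume d n k (voxel_complex d n \<omega>))
    = ?f (1 - p)" if "p \<in> {0..1}" "n \<ge> 2" for n :: nat and p
    using that sum_cube_intrinsic_volume[OF assms, of "1 - p"]
    by (simp add: expectation_intrinsic_volume)
  then show ?thesis
    by (intro exI[of _ E] conjI allI ballI impI) (simp_all only: E)
qed

end
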